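(* Let $E$ be a finite set, $k\ge0$ an integer and $\mathcal{F}\subseteq2^E$. Then $(E,\mathcal{F})$ is a $k$-truncated antimatroid if and only if there exists a $(k-1)$-isotone operator $\Psi$ on $E$ such that $\mathcal{F}=\mathcal{F}(\Psi)$.
   Context: A set system $(E,\mathcal{A})$ with $\mathcal{A}\ne\emptyset$ is an antimatroid if (A1) for each nonempty $X\in\mathcal{A}$ there is $x\in X$ with $X\setminus\{x\}\in\mathcal{A}$, and (A2) for all $X,Y\in\mathcal{A}$ with $X\not\subseteq Y$ there is $x\in X\setminus Y$ with $Y\cup\{x\}\in\mathcal{A}$. $(E,\mathcal{F})$ is a $k$-truncated antimatroid if there is an antimatroid $(E,\mathcal{A})$ with $\mathcal{F}=\{X\in\mathcal{A}:|X|\le k\}$. A $(k-1)$-isotone operator is a map $\Psi:2^E\to2^E$ with $\Psi(X)\subseteq E\setminus X$ for all $X$, such that $\Psi(X)\cap(E\setminus Y)\subseteq\Psi(Y)$ whenever $X\subseteq Y\subseteq E$ and $|Y|\le k-1$, and $\Psi(X)=\emptyset$ whenever $|X|\ge k$. $\mathcal{F}(\Psi)$ is the family of all $X\subseteq E$ for which there exist $x_1,\dots,x_m$ ($m\ge0$) with $X=\{x_1,\dots,x_m\}$ and $x_i\in\Psi(\{x_1,\dots,x_{i-1}\})$ for $1\le i\le m$. *)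

theory Defs
  imports Main
begin

definition antimatroid :: "'a set \<Rightarrow> 'a set set \<Rightarrow> bool" where
  "antimatroid E \<A> \<longleftrightarrow>
     \<A> \<subseteq> Pow E \<and> \<A> \<noteq> {} \<and>
     (\<forall>X\<in>\<A>. X \<noteq> {} \<longrightarrow> (\<exists>x\<in>X. X - {x} \<in> \<A>)) \<and>
     (\<forall>X\<in>\<A>. \<forall>Y\<in>\<A>. \<not> X \<subseteq> Y \<longrightarrow> (\<exists>x\<in>X - Y. Y \<union> {x} \<in> \<A>))"

definition truncated_antimatroid :: "nat \<Rightarrow> 'a set \<Rightarrow> 'a set set \<Rightarrow> bool" where
  "truncated_antimatroid k E \<F> \<longleftrightarrow>
     (\<exists>\<A>. antimatroid E \<A> \<and> \<F> = {X \<in> \<A>. card X \<le> k})"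

text \<open>The index \<open>j\<close> is an integer because the \<open>(k - 1)\<close>-isotone operators are also
  needed for \<open>k = 0\<close>.  A map from subsets of \<open>E\<close> to subsets of \<open>E\<close> is represented by a total
  function whose values outside the subsets of \<open>E\<close> are unconstrained and never used.\<close>

definition isotone_operator :: "int \<Rightarrow> 'a set \<Rightarrow> ('a set \<Rightarrow> 'a set) \<Rightarrow> bool" where
  "isotone_operator j E \<Psi> \<longleftrightarrow>
     (\<forall>X. X \<subseteq> E \<longrightarrow> \<Psi> X \<subseteq> E - X) \<and>
     (\<forall>X Y. X \<subseteq> Y \<longrightarrow> Y \<subseteq> E \<longrightarrow> int (card Y) \<le> j \<longrightarrow> \<Psi> X \<inter> (E - Y) \<subseteq> \<Psi> Y) \<and>
     (\<forall>X. X \<subseteq> E \<longrightarrow> int (card X) \<ge> j + 1 \<longrightarrow> \<Psi> X = {})"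

text \<open>The list \<open>xs\<close> is the sequence \<open>x\<^sub>1, \<dots>, x\<^sub>m\<close>, indexed from \<open>0\<close>.\<close>

definition operator_family :: "'a set \<Rightarrow> ('a set \<Rightarrow> 'a set) \<Rightarrow> 'a set set" where
  "operator_family E \<Psi> =
     {X. X \<subseteq> E \<and> (\<exists>xs. X = set xs \<and> (\<forall>i<length xs. xs ! i \<in> \<Psi> (set (take i xs))))}"

end

theory Submission
  imports Defs
begin

text \<open>
  An antimatroid \<open>\<A>\<close> yields the operator sending \<open>X\<close> with \<open>|X| < k\<close> to all \<open>x \<notin> X\<close> such that
  \<open>Z\<close> and \<open>Z \<union> {x}\<close> lie in \<open>\<A>\<close> for some \<open>Z \<subseteq> X\<close>; by (A2) such an \<open>x\<close> can be added to \<open>X\<close> itself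
  whenever \<open>X \<in> \<A>\<close>.  Conversely, the operator \<open>X \<mapsto> (\<Union>Z\<subseteq>X. \<Psi> Z) - X\<close> is isotone without a bound
  on cardinalities, so that its family is an antimatroid, and it agrees with \<open>\<Psi>\<close> on sets of
  size less than \<open>k\<close>, so that truncating its family at \<open>k\<close> gives back the family of \<open>\<Psi>\<close>.
\<close>

text \<open>Growing a set one element at a time gives rule induction in place of index bookkeeping
  on lists. Freshness of \<open>x\<close> is not built in; it follows later from
  \<open>\<Psi> X \<subseteq> E - X\<close>.\<close>

inductive feasible :: "('a set \<Rightarrow> 'a set) \<Rightarrow> 'a set \<Rightarrow> bool" for \<Psi> where
  empty: "feasible \<Psi> {}"
| insert: "feasible \<Psi> X \<Longrightarrow> x \<in> \<Psi> X \<Longrightarrow> feasible \<Psi> (insert x X)"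

text \<open>The list records the order of insertion. Both directions work at its end, since
  appending an element leaves all earlier prefixes unchanged.\<close>

lemma feasible_iff_list:
  "feasible \<Psi> X \<longleftrightarrow> (\<exists>xs. X = set xs \<and> (\<forall>i<length xs. xs ! i \<in> \<Psi> (set (take i xs))))"
proof
  assume "feasible \<Psi> X"
  then show "\<exists>xs. X = set xs \<and> (\<forall>i<length xs. xs ! i \<in> \<Psi> (set (take i xs)))"
  proof induction
    case empty
    show ?case by (intro exI[of _ "[]"]) simp
  next
    case (insert X x)
    then obtain xs where "X = set xs" "\<forall>i<length xs. xs ! i \<in> \<Psi> (set (take i xs))" by blast
    with insert.hyps show ?case
      by (intro exI[of _ "xs @ [x]"]) (auto simp: nth_append less_Suc_eq)
  qed
next
  have "feasible \<Psi> (set xs)" if "\<forall>i<length xs. xs ! i \<in> \<Psi> (set (take i xs))" for xs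
    using that
  proof (induction xs rule: rev_induct)
    case Nil
    show ?case by (simp add: feasible.empty)
  next
    case (snoc x xs)
    have "\<forall>i<length xs. xs ! i \<in> \<Psi> (set (take i xs))"
    proof (intro allI impI)
      fix i assume "i < length xs"
      with snoc.prems[rule_format, of i] show "xs ! i \<in> \<Psi> (set (take i xs))"
        by (simp add: nth_append)
    qed
    moreover have "x \<in> \<Psi> (set xs)"
      using snoc.prems[rule_format, of "length xs"] by simp
    ultimately show ?case
      using snoc.IH by (simp add: feasible.insert)
  qed
  then show "\<exists>xs. X = set xs \<and> (\<forall>i<length xs. xs ! i \<in> \<Psi> (set (take i xs))) \<Longrightarrow> feasible \<Psi> X"
    by blast
qed

lemma operator_family_eq: "operator_family E \<Psi> = {X. X \<subseteq> E \<and> feasible \<Psi> X}"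
  by (auto simp: operator_family_def feasible_iff_list)

lemma feasible_finite: "feasible \<Psi> X \<Longrightarrow> finite X"
  by (induction rule: feasible.induct) auto

text \<open>For (A1), undo the last insertion. For (A2), follow a construction of \<open>X\<close>
  up to the first element outside \<open>Y\<close>: the set built before it lies in
  \<open>Y\<close>, so isotony lets that element extend \<open>Y\<close>.\<close>

lemma antimatroid_operator_family:
  assumes avoid: "\<And>X. X \<subseteq> E \<Longrightarrow> \<Psi> X \<subseteq> E - X"
    and isotone: "\<And>X Y. X \<subseteq> Y \<Longrightarrow> Y \<subseteq> E \<Longrightarrow> \<Psi> X - Y \<subseteq> \<Psi> Y"
  shows "antimatroid E (operator_family E \<Psi>)"
proof -
  have removable: "\<exists>x\<in>X. feasible \<Psi> (X - {x})" if "feasible \<Psi> X" "X \<subseteq> E" "X \<noteq> {}" for X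
    using that
  proof cases
    case (insert Z x)
    \<comment> \<open>Hence deleting \<open>x\<close> gives back exactly \<open>Z\<close>.\<close>
    moreover have "x \<notin> Z" using avoid[of Z] insert that(2) by auto
    ultimately show ?thesis by auto
  qed simp
  have extendable: "\<exists>x\<in>X - Y. feasible \<Psi> (insert x Y)"
    if "feasible \<Psi> X" "feasible \<Psi> Y" "Y \<subseteq> E" "\<not> X \<subseteq> Y" for X Y
    using that
  proof (induction rule: feasible.induct)
    case (insert X x)
    show ?case
    proof (cases "X \<subseteq> Y")
      case True
      then have "x \<notin> Y" "x \<in> \<Psi> Y" using insert isotone[of X Y] by auto
      with insert.prems show ?thesis by (auto intro: feasible.insert)
    next
      case False
      with insert show ?thesis by auto
    qed
  qed simp
  have "{} \<in> operator_family E \<Psi>"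
    by (simp add: operator_family_eq feasible.empty)
  moreover have "\<exists>x\<in>X. X - {x} \<in> operator_family E \<Psi>"
    if "X \<in> operator_family E \<Psi>" "X \<noteq> {}" for X
    using removable[of X] that by (auto simp: operator_family_eq)
  moreover have "\<exists>x\<in>X - Y. Y \<union> {x} \<in> operator_family E \<Psi>"
    if "X \<in> operator_family E \<Psi>" "Y \<in> operator_family E \<Psi>" "\<not> X \<subseteq> Y" for X Y
    using extendable[of X Y] that by (auto simp: operator_family_eq)
  moreover have "operator_family E \<Psi> \<subseteq> Pow E"
    by (auto simp: operator_family_eq)
  ultimately show ?thesis
    unfolding antimatroid_def by blast
qed

text \<open>The operators allow the same steps from sets with fewer than \<open>k\<close> elements.
  \<open>\<Psi>\<close> allows no others, and every set passed on the way to a set of size at most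
  \<open>k\<close> by \<open>\<Phi>\<close> is that small except the last.\<close>

lemma operator_family_truncation:
  assumes avoid: "\<And>X. X \<subseteq> E \<Longrightarrow> \<Phi> X \<subseteq> E - X"
    and agree: "\<And>X. X \<subseteq> E \<Longrightarrow> card X < k \<Longrightarrow> \<Psi> X = \<Phi> X"
    and stop: "\<And>X. X \<subseteq> E \<Longrightarrow> k \<le> card X \<Longrightarrow> \<Psi> X = {}"
  shows "operator_family E \<Psi> = {X \<in> operator_family E \<Phi>. card X \<le> k}"
proof -
  have "feasible \<Phi> X \<and> card X \<le> k" if "feasible \<Psi> X" "X \<subseteq> E" for X
    using that
  proof (induction rule: feasible.induct)
    case (insert X x)
    then have "X \<subseteq> E" by simp
    \<comment> \<open>Otherwise \<open>\<Psi> X\<close> would be empty, but it contains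
      \<open>x\<close>.\<close>
    with insert.hyps stop[of X] have "card X < k" by (cases "card X < k") auto
    moreover have "card (insert x X) \<le> Suc (card X)"
      by (rule card_insert_le_m1) simp_all
    ultimately show ?case
      using insert agree[of X] \<open>X \<subseteq> E\<close> by (auto intro: feasible.insert)
  qed (simp add: feasible.empty)
  moreover have "feasible \<Psi> X" if "feasible \<Phi> X" "X \<subseteq> E" "card X \<le> k" for X
    using that
  proof (induction rule: feasible.induct)
    case (insert X x)
    then have "X \<subseteq> E" by simp
    with avoid[of X] insert.hyps have "x \<notin> X" by auto
    \<comment> \<open>A step of \<open>\<Phi>\<close> adds a new element to a finite set, so the
      cardinality strictly grows.\<close>
    with insert.prems feasible_finite[OF insert.hyps(1)] have "card X < k" by simp
    with insert agree[of X] \<open>X \<subseteq> E\<close> show ?case by (auto intro: feasible.insert)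
  qed (simp add: feasible.empty)
  ultimately show ?thesis
    by (auto simp: operator_family_eq)
qed

lemma truncated_antimatroid_operator_family:
  assumes "isotone_operator (int k - 1) E \<Psi>"
  shows "truncated_antimatroid k E (operator_family E \<Psi>)"
proof -
  define \<Phi> where "\<Phi> X = (\<Union>Z\<in>Pow X. \<Psi> Z) - X" for X
  have \<Psi>: "\<And>X. X \<subseteq> E \<Longrightarrow> \<Psi> X \<subseteq> E - X"
    "\<And>X Y. X \<subseteq> Y \<Longrightarrow> Y \<subseteq> E \<Longrightarrow> card Y < k \<Longrightarrow> \<Psi> X \<inter> (E - Y) \<subseteq> \<Psi> Y"
    "\<And>X. X \<subseteq> E \<Longrightarrow> k \<le> card X \<Longrightarrow> \<Psi> X = {}"
    using assms by (auto simp: isotone_operator_def)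
  have avoid: "\<Phi> X \<subseteq> E - X" if "X \<subseteq> E" for X
    using \<Psi>(1) that unfolding \<Phi>_def by blast
  have "\<Phi> X - Y \<subseteq> \<Phi> Y" if "X \<subseteq> Y" for X Y
    using that by (auto simp: \<Phi>_def)
  with avoid have "antimatroid E (operator_family E \<Phi>)"
    by (intro antimatroid_operator_family)
  moreover have "\<Psi> X = \<Phi> X" if "X \<subseteq> E" "card X < k" for X
  proof
    show "\<Psi> X \<subseteq> \<Phi> X" using \<Psi>(1)[of X] that by (auto simp: \<Phi>_def)
    show "\<Phi> X \<subseteq> \<Psi> X"
    proof
      fix x assume x: "x \<in> \<Phi> X"
      then obtain Z where "Z \<subseteq> X" "x \<in> \<Psi> Z" by (auto simp: \<Phi>_def)
      \<comment> \<open>The bound \<open>card X < k\<close> is what permits isotony of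
        \<open>\<Psi>\<close> from \<open>Z\<close> to \<open>X\<close>.\<close>
      with \<Psi>(2)[of Z X] avoid[of X] x that show "x \<in> \<Psi> X" by blast
    qed
  qed
  then have "operator_family E \<Psi> = {X \<in> operator_family E \<Phi>. card X \<le> k}"
    using avoid \<Psi>(3) by (intro operator_family_truncation)
  ultimately show ?thesis
    unfolding truncated_antimatroid_def by blast
qed

text \<open>Start from any member and delete elements by (A1); finiteness makes this end at the
  empty set.\<close>

lemma antimatroid_empty:
  assumes "finite E" "antimatroid E \<A>"
  shows "{} \<in> \<A>"
proof -
  have A1: "\<And>X. X \<in> \<A> \<Longrightarrow> X \<noteq> {} \<Longrightarrow> \<exists>x\<in>X. X - {x} \<in> \<A>"
    using assms(2) by (auto simp: antimatroid_def)
  have "{} \<in> \<A>" if "X \<in> \<A>" "finite X" for X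
    using that(2,1)
  proof (induction rule: finite_psubset_induct)
    case (psubset X)
    show ?case
    proof (cases "X = {}")
      case False
      then obtain x where "x \<in> X" "X - {x} \<in> \<A>"
        using A1 psubset.prems by blast
      then show ?thesis using psubset.IH[of "X - {x}"] by blast
    qed (use psubset.prems in simp)
  qed
  moreover obtain X where "X \<in> \<A>" "X \<subseteq> E"
    using assms(2) by (auto simp: antimatroid_def)
  ultimately show ?thesis
    using assms(1) finite_subset by blast
qed

lemma antimatroid_truncation_operator:
  assumes "finite E" "antimatroid E \<A>"
  shows "\<exists>\<Psi>. isotone_operator (int k - 1) E \<Psi> \<and> {X \<in> \<A>. card X \<le> k} = operator_family E \<Psi>"
proof -
  define \<Phi> where "\<Phi> X = {x \<in> E - X. \<exists>Z\<subseteq>X. Z \<in> \<A> \<and> insert x Z \<in> \<A>}" for X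
  define \<Psi> where "\<Psi> X = (if card X < k then \<Phi> X else {})" for X
  have subsets: "\<And>X. X \<in> \<A> \<Longrightarrow> X \<subseteq> E"
    and A1: "\<And>X. X \<in> \<A> \<Longrightarrow> X \<noteq> {} \<Longrightarrow> \<exists>x\<in>X. X - {x} \<in> \<A>"
    and A2: "\<And>X Y. X \<in> \<A> \<Longrightarrow> Y \<in> \<A> \<Longrightarrow> \<not> X \<subseteq> Y \<Longrightarrow> \<exists>x\<in>X - Y. insert x Y \<in> \<A>"
    using assms(2) by (auto simp: antimatroid_def)
  have "X \<in> \<A>" if "feasible \<Phi> X" for X
    using that
  proof (induction rule: feasible.induct)
    case empty
    show ?case using antimatroid_empty[OF assms] .
  next
    case (insert X x)
    then obtain Z where "Z \<subseteq> X" "insert x Z \<in> \<A>" "x \<notin> X" by (auto simp: \<Phi>_def)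
    \<comment> \<open>As \<open>Z \<subseteq> X\<close>, the only element that (A2) can transfer
      from \<open>insert x Z\<close> to \<open>X\<close> is \<open>x\<close> itself.\<close>
    with A2[of "insert x Z" X] insert.IH show ?case by auto
  qed
  moreover have "feasible \<Phi> X" if "X \<in> \<A>" for X
    using finite_subset[OF subsets[OF that] assms(1)] that
  proof (induction rule: finite_psubset_induct)
    case (psubset X)
    show ?case
    proof (cases "X = {}")
      case False
      then obtain x where x: "x \<in> X" "X - {x} \<in> \<A>" using A1 psubset.prems by blast
      then have "feasible \<Phi> (X - {x})" using psubset.IH[of "X - {x}"] by blast
      moreover have "insert x (X - {x}) = X" using x(1) by blast
      \<comment> \<open>The set \<open>X - {x}\<close> serves as its own witness
        \<open>Z\<close>.\<close>
      moreover from this x have "x \<in> \<Phi> (X - {x})"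
        using psubset.prems subsets[OF psubset.prems] by (auto simp: \<Phi>_def)
      ultimately show ?thesis by (metis feasible.insert)
    qed (simp add: feasible.empty)
  qed
  ultimately have "\<A> = operator_family E \<Phi>"
    using subsets by (auto simp: operator_family_eq)
  moreover have "operator_family E \<Psi> = {X \<in> operator_family E \<Phi>. card X \<le> k}"
    by (rule operator_family_truncation) (auto simp: \<Phi>_def \<Psi>_def)
  moreover have "isotone_operator (int k - 1) E \<Psi>"
    unfolding isotone_operator_def
  proof (intro conjI allI impI)
    fix X Y :: "'a set"
    assume "X \<subseteq> Y" "int (card Y) \<le> int k - 1"
    \<comment> \<open>A witness \<open>Z \<subseteq> X\<close> is also one for \<open>Y\<close>; if
      \<open>card X < k\<close> fails, then \<open>\<Psi> X\<close> is empty.\<close>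
    then show "\<Psi> X \<inter> (E - Y) \<subseteq> \<Psi> Y"
      by (auto simp: \<Psi>_def \<Phi>_def)
  qed (auto simp: \<Psi>_def \<Phi>_def)
  ultimately show ?thesis by blast
qed

theorem theorem4:
  fixes E :: "'a set" and k :: nat and \<F> :: "'a set set"
  assumes "finite E" and "\<F> \<subseteq> Pow E"
  shows "truncated_antimatroid k E \<F> \<longleftrightarrow>
    (\<exists>\<Psi>. isotone_operator (int k - 1) E \<Psi> \<and> \<F> = operator_family E \<Psi>)"
proof
  assume "truncated_antimatroid k E \<F>"
  then obtain \<A> where "antimatroid E \<A>" "\<F> = {X \<in> \<A>. card X \<le> k}"
    unfolding truncated_antimatroid_def by blast
  with antimatroid_truncation_operator[OF assms(1)]
  show "\<exists>\<Psi>. isotone_operator (int k - 1) E \<Psi> \<and> \<F> = operator_family E \<Psi>" by metis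
next
  assume "\<exists>\<Psi>. isotone_operator (int k - 1) E \<Psi> \<and> \<F> = operator_family E \<Psi>"
  then show "truncated_antimatroid k E \<F>"
    using truncated_antimatroid_operator_family by auto
qed

end
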